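(* Let $n,w,d\ge1$, $N=2^n$, and let $\mathbb{F}$ be a field containing an element of multiplicative order at least $(Ndw^2)^2$ and at least $w^2$ distinct elements. In the space of multilinear polynomials in $x_1,\ldots,x_n$, the set of (multilinear) polynomials computed by width-$w^2$, length-$n$ roABPs is a succinct hitting set for the class of $N$-variate polynomials of individual degree at most $d$ computed by width-$w$, length-$N$ roABPs that read their variables in a monomial-compatible ordering; that is, for every non-zero such $F\in\mathbb{F}[X_1,\ldots,X_N]$ there is a multilinear $f\in\mathbb{F}[x_1,\ldots,x_n]$ computed by a width-$w^2$ roABP of length $n$ such that $F(\mathrm{coeff}(f))\ne0$.
   Context: A read-once oblivious algebraic branching program (roABP) of width $w$ and length $L$ in variables $X_1,\ldots,X_L$ and variable order $\sigma$ computes $\big(\prod_{i=1}^L M_i(X_{\sigma(i)})\big)_{1,1}$ where each $M_i$ is a $w\times w$ matrix whose entries are univariate polynomials in $X_{\sigma(i)}$. For multilinear $f\in\mathbb{F}[x_1,\ldots,x_n]$, $\mathrm{coeff}(f)\in\mathbb{F}^{2^n}$ is its vector of coefficients in the multilinear monomial basis, and multilinear monomials are identified with indices in $[N]$ via binary representation (so $\mathrm{coeff}(f)$ is plugged in for $X_1,\ldots,X_N$). A monomial-compatible ordering of $X_1,\ldots,X_N$ is an ordering obtained from some permutation $\sigma$ of $[n]$ by ordering the multilinear monomials in $x_1,\ldots,x_n$ lexicographically with respect to the variable order $\sigma$ and transporting this order to $[N]$ via the canonical identification of multilinear monomials with indices; there are $n!$ such orderings. *)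

theory Defs
  imports "HOL-Library.Poly_Mapping" "HOL-Computational_Algebra.Polynomial"
begin

text \<open>Multivariate polynomials over 'a in variables indexed by nat:
  a monomial is a finitely supported exponent map (nat to nat),
  a polynomial is a finitely supported coefficient map on monomials.\<close>
type_synonym 'a mpoly = "(nat \<Rightarrow>\<^sub>0 nat) \<Rightarrow>\<^sub>0 'a"

definition var_poly :: "nat \<Rightarrow> 'a::comm_ring_1 poly \<Rightarrow> 'a mpoly" where
  "var_poly v p = (\<Sum>k\<le>degree p. Poly_Mapping.single (Poly_Mapping.single v k) (coeff p k))"

definition mat_mult :: "nat \<Rightarrow> (nat \<Rightarrow> nat \<Rightarrow> 'a::comm_ring_1) \<Rightarrow> (nat \<Rightarrow> nat \<Rightarrow> 'a) \<Rightarrow> nat \<Rightarrow> nat \<Rightarrow> 'a" where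
  "mat_mult w A B = (\<lambda>i j. \<Sum>k<w. A i k * B k j)"

fun abp_prod :: "nat \<Rightarrow> (nat \<times> (nat \<Rightarrow> nat \<Rightarrow> 'a::comm_ring_1 poly)) list \<Rightarrow> nat \<Rightarrow> nat \<Rightarrow> 'a mpoly" where
  "abp_prod w [] = (\<lambda>i j. if i = j then 1 else 0)"
| "abp_prod w ((v, M) # rest) = mat_mult w (\<lambda>i j. var_poly v (M i j)) (abp_prod w rest)"

text \<open>F is computed by a width-w, length-L roABP reading variable ord t at step t (t < L):
  F = (prod_t M_t(X_{ord t}))_{1,1}  (entry (1,1) is index (0,0) here).\<close>
definition roABP_computes :: "nat \<Rightarrow> nat \<Rightarrow> (nat \<Rightarrow> nat) \<Rightarrow> 'a::comm_ring_1 mpoly \<Rightarrow> bool" where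
  "roABP_computes w L ord F \<longleftrightarrow>
     (\<exists>Ms :: (nat \<Rightarrow> nat \<Rightarrow> 'a poly) list. length Ms = L \<and>
        F = abp_prod w (zip (map ord [0..<L]) Ms) 0 0)"

definition multilinear :: "'a::zero mpoly \<Rightarrow> bool" where
  "multilinear f \<longleftrightarrow> (\<forall>m\<in>Poly_Mapping.keys f. \<forall>v. Poly_Mapping.lookup m v \<le> 1)"

definition ind_degree_le :: "nat \<Rightarrow> 'a::zero mpoly \<Rightarrow> bool" where
  "ind_degree_le d F \<longleftrightarrow> (\<forall>m\<in>Poly_Mapping.keys F. \<forall>v. Poly_Mapping.lookup m v \<le> d)"

definition ml_monomial :: "nat \<Rightarrow> nat \<Rightarrow> (nat \<Rightarrow>\<^sub>0 nat)" where
  "ml_monomial n j = (\<Sum>i\<in>{i. i < n \<and> bit j i}. Poly_Mapping.single i 1)"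

definition coeff_vec :: "nat \<Rightarrow> 'a::zero mpoly \<Rightarrow> nat \<Rightarrow> 'a" where
  "coeff_vec n f j = Poly_Mapping.lookup f (ml_monomial n j)"

definition mpoly_eval :: "(nat \<Rightarrow> 'a::comm_ring_1) \<Rightarrow> 'a mpoly \<Rightarrow> 'a" where
  "mpoly_eval a p = (\<Sum>m\<in>Poly_Mapping.keys p. Poly_Mapping.lookup p m * (\<Prod>v\<in>Poly_Mapping.keys m. a v ^ Poly_Mapping.lookup m v))"

text \<open>Position of the monomial with index j in the lexicographic order of multilinear
  monomials with respect to the variable order sigma 0, sigma 1, ..., sigma (n-1)
  (sigma 0 most significant).\<close>
definition mc_rank :: "nat \<Rightarrow> (nat \<Rightarrow> nat) \<Rightarrow> nat \<Rightarrow> nat" where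
  "mc_rank n \<sigma> j = (\<Sum>i<n. if bit j (\<sigma> i) then 2 ^ (n - 1 - i) else 0)"

definition monomial_compatible :: "nat \<Rightarrow> (nat \<Rightarrow> nat) \<Rightarrow> bool" where
  "monomial_compatible n ord \<longleftrightarrow>
     (\<exists>\<sigma>. bij_betw \<sigma> {..<n} {..<n} \<and> (\<forall>j<2^n. ord (mc_rank n \<sigma> j) = j))"

end

theory Submission
  imports Defs "HOL-Library.Function_Algebras"
begin

text \<open>
  Position \<open>p\<close> of the large roABP, written in binary, is a leaf of a binary tree, and a
  monomial-compatible ordering makes the bits of \<open>p\<close>, from the most significant one, the exponents of
  \<open>x\<^bsub>\<sigma> 0\<^esub>, x\<^bsub>\<sigma> 1\<^esub>, \<dots>\<close>. Start from a point of non-vanishing and merge neighbouring blocks level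
  by level. The partial product over a block is a \<open>w \<times> w\<close> matrix, so among the values of the product
  of two neighbouring blocks at most \<open>w\<^sup>2\<close> are needed to span all of them; as the field is large, the
  same \<open>w\<^sup>2\<close> pairs of arguments do this for all blocks of a level simultaneously. A non-zero total
  product therefore stays non-zero for some choice among these \<open>w\<^sup>2\<close> arguments in each merged block.
  The \<open>w\<^sup>2\<close> resulting vectors of leaf values are then joined by an interpolating curve, which is the
  one-parameter family entering the next level. Interpolating the leaf values, and not composing
  with the previous curves, keeps the degrees below \<open>N d w\<^sup>2\<close>, and it makes the leaf values after all
  \<open>n\<close> levels a product of \<open>w\<^sup>2 \<times> w\<^sup>2\<close> matrices, one for each bit of \<open>p\<close>: this is the small roABP.
\<close>

abbreviation lookup where "lookup \<equiv> Poly_Mapping.lookup"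
abbreviation keys where "keys \<equiv> Poly_Mapping.keys"
abbreviation single where "single \<equiv> Poly_Mapping.single"

section \<open>Products of matrices\<close>

fun mprod :: "nat \<Rightarrow> (nat \<Rightarrow> nat \<Rightarrow> 'a::comm_ring_1) list \<Rightarrow> nat \<Rightarrow> nat \<Rightarrow> 'a" where
  "mprod w [] = (\<lambda>i j. if i = j then 1 else 0)"
| "mprod w (A # As) = mat_mult w A (mprod w As)"

lemma mprod_append:
  assumes "i < w"
  shows "mprod w (As @ Bs) i j = (\<Sum>k<w. mprod w As i k * mprod w Bs k j)"
  using assms
proof (induction As arbitrary: i)
  case Nil
  then have "(\<Sum>k<w. mprod w [] i k * mprod w Bs k j) = (\<Sum>k<w. if k = i then mprod w Bs k j else 0)"
    by (intro sum.cong) auto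
  with Nil show ?case by simp
next
  case (Cons A As)
  have "mprod w ((A # As) @ Bs) i j = (\<Sum>l<w. A i l * (\<Sum>k<w. mprod w As l k * mprod w Bs k j))"
    by (simp add: mat_mult_def Cons.IH)
  also have "\<dots> = (\<Sum>l<w. \<Sum>k<w. A i l * mprod w As l k * mprod w Bs k j)"
    by (simp add: sum_distrib_left mult.assoc)
  also have "\<dots> = (\<Sum>k<w. \<Sum>l<w. A i l * mprod w As l k * mprod w Bs k j)"
    by (rule sum.swap)
  finally show ?case by (simp add: mat_mult_def sum_distrib_right)
qed

lemma mprod_cong:
  assumes "\<And>t i j. t \<in> set ts \<Longrightarrow> i < w \<Longrightarrow> j < w \<Longrightarrow> f t i j = g t i j" "i < w" "j < w"
  shows "mprod w (map f ts) i j = mprod w (map g ts) i j"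
  using assms
  by (induction ts arbitrary: i) (auto simp: mat_mult_def intro!: sum.cong)

lemma mprod_concat:
  assumes "i < w"
  shows "mprod w (concat Ass) i j = mprod w (map (mprod w) Ass) i j"
  using assms
  by (induction Ass arbitrary: i) (auto simp: mprod_append mat_mult_def)

lemma mprod_zero:
  assumes "t \<in> set ts" "\<And>i j. A t i j = 0"
  shows "mprod w (map A ts) i j = 0"
  using assms
  by (induction ts arbitrary: i j) (auto simp: mat_mult_def)

definition eval_mat :: "(nat \<Rightarrow> nat \<Rightarrow> 'a::comm_ring_1 poly) \<Rightarrow> 'a \<Rightarrow> nat \<Rightarrow> nat \<Rightarrow> 'a" where
  "eval_mat A s = (\<lambda>i j. poly (A i j) s)"

lemma poly_mprod: "poly (mprod w As i j) s = mprod w (map (\<lambda>A. eval_mat A s) As) i j"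
  by (induction As arbitrary: i j) (auto simp: mat_mult_def eval_mat_def poly_sum)

lemma degree_mprod_le:
  assumes "\<And>A i j. A \<in> set As \<Longrightarrow> degree (A i j) \<le> e"
  shows "degree (mprod w As i j) \<le> length As * e"
  using assms
proof (induction As arbitrary: i j)
  case (Cons A As)
  show ?case unfolding mprod.simps mat_mult_def
  proof (intro degree_sum_le)
    fix k
    have "degree (A i k) \<le> e" "degree (mprod w As k j) \<le> length As * e"
      using Cons by auto
    then show "degree (A i k * mprod w As k j) \<le> length (A # As) * e"
      using degree_mult_le[of "A i k" "mprod w As k j"] by simp
  qed auto
qed auto

section \<open>Coefficients and values of polynomials computed by branching programs\<close>

lemma poly_mapping_sum_single:
  "p = (\<Sum>m\<in>keys p. single m (lookup p m))"
proof (rule poly_mapping_eqI)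
  fix k
  show "lookup p k = lookup (\<Sum>m\<in>keys p. single m (lookup p m)) k"
    by (auto simp: lookup_sum lookup_single when_def in_keys_iff)
qed

lemma lookup_single_mult_add:
  fixes q :: "'b::cancel_comm_monoid_add \<Rightarrow>\<^sub>0 'a::comm_ring_1"
  shows "lookup (single s c * q) (s + t) = c * lookup q t"
proof -
  have "single s c * q = (\<Sum>m\<in>keys q. single (s + m) (c * lookup q m))"
    by (subst poly_mapping_sum_single[of q]) (simp add: sum_distrib_left mult_single)
  then show ?thesis
    by (auto simp: lookup_sum lookup_single when_def in_keys_iff)
qed

lemma lookup_single_mult_eq_0:
  fixes q :: "'b::cancel_comm_monoid_add \<Rightarrow>\<^sub>0 'a::comm_ring_1"
  assumes "\<And>t. m = s + t \<Longrightarrow> lookup q t = 0"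
  shows "lookup (single s c * q) m = 0"
proof -
  have "single s c * q = (\<Sum>m\<in>keys q. single (s + m) (c * lookup q m))"
    by (subst poly_mapping_sum_single[of q]) (simp add: sum_distrib_left mult_single)
  with assms show ?thesis
    by (auto simp: lookup_sum lookup_single when_def intro!: sum.neutral)
qed

text \<open>Since \<open>q\<close> does not involve the variable \<open>v\<close>, only the term of
  \<open>p\<close> whose exponent is that of \<open>v\<close> in \<open>m\<close> can contribute to
  the coefficient of \<open>m\<close>.\<close>

lemma lookup_var_poly_mult:
  fixes q :: "'a::comm_ring_1 mpoly"
  assumes "\<And>m. m \<in> keys q \<Longrightarrow> lookup m v = 0"
  shows "lookup (var_poly v p * q) m = coeff p (lookup m v) * lookup q (Poly_Mapping.update v 0 m)"
proof -
  let ?k = "lookup m v"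
  have m: "m = single v ?k + Poly_Mapping.update v 0 m"
    by (rule poly_mapping_eqI) (auto simp: lookup_add lookup_single lookup_update when_def)
  have *: "lookup (single (single v k) c * q) m
      = (if k = ?k then c * lookup q (Poly_Mapping.update v 0 m) else 0)" for k c
  proof (cases "k = ?k")
    case True
    then show ?thesis using lookup_single_mult_add[of "single v ?k" c q "Poly_Mapping.update v 0 m"]
      by (simp add: m[symmetric])
  next
    case False
    have "lookup q t = 0" if "m = single v k + t" for t
    proof (rule ccontr)
      assume "lookup q t \<noteq> 0"
      then have "lookup t v = 0" using assms by (simp add: in_keys_iff)
      with that False show False by (simp add: lookup_add)
    qed
    with False show ?thesis by (simp add: lookup_single_mult_eq_0)
  qed
  have "lookup (var_poly v p * q) m = (\<Sum>k\<le>degree p. lookup (single (single v k) (coeff p k) * q) m)"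
    by (simp add: var_poly_def sum_distrib_right lookup_sum)
  also have "\<dots> = (\<Sum>k\<le>degree p. if k = ?k then coeff p k * lookup q (Poly_Mapping.update v 0 m) else 0)"
    by (simp only: *)
  also have "\<dots> = coeff p ?k * lookup q (Poly_Mapping.update v 0 m)"
    by (auto simp: coeff_eq_0)
  finally show ?thesis .
qed

text \<open>Each variable is read only once, so its exponent in \<open>m\<close> determines which
  coefficient of the entries of its matrix contributes. Hence the coefficient of \<open>m\<close> is
  again a matrix product, now of scalar matrices.\<close>

lemma lookup_abp_prod:
  assumes "distinct (map fst xs)"
  shows "lookup (abp_prod w xs i j) m =
    (if keys m \<subseteq> fst ` set xs
     then mprod w (map (\<lambda>(v, M) i j. coeff (M i j) (lookup m v)) xs) i j else 0)"
  using assms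
proof (induction xs arbitrary: i j m)
  case Nil
  show ?case by (auto simp: lookup_one when_def)
next
  case (Cons x xs)
  obtain v M where x: "x = (v, M)" by (cases x)
  let ?m = "Poly_Mapping.update v 0 m"
  have v: "v \<notin> fst ` set xs" and d: "distinct (map fst xs)"
    using Cons.prems x by auto
  have nov: "lookup m' v = 0" if "m' \<in> keys (abp_prod w xs k j)" for m' k
    using that v unfolding in_keys_iff Cons.IH[OF d]
    by (auto simp: in_keys_iff split: if_splits)
  have k: "keys ?m \<subseteq> fst ` set xs \<longleftrightarrow> keys m \<subseteq> fst ` set (x # xs)"
  proof -
    have "keys ?m = keys m - {v}" by (auto simp: in_keys_iff lookup_update split: if_splits)
    with v x show ?thesis by auto
  qed
  have c: "map (\<lambda>(v, M) i j. coeff (M i j) (lookup ?m v)) xs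
      = map (\<lambda>(v, M) i j. coeff (M i j) (lookup m v)) xs"
    using v by (force simp: lookup_update)
  have "lookup (abp_prod w (x # xs) i j) m
      = (\<Sum>k<w. coeff (M i k) (lookup m v) * lookup (abp_prod w xs k j) ?m)"
    by (simp add: x mat_mult_def lookup_sum lookup_var_poly_mult nov)
  also have "\<dots> = (\<Sum>k<w. coeff (M i k) (lookup m v) * (if keys m \<subseteq> fst ` set (x # xs)
     then mprod w (map (\<lambda>(v, M) i j. coeff (M i j) (lookup m v)) xs) k j else 0))"
    unfolding Cons.IH[OF d] k c ..
  finally show ?case by (auto simp: x mat_mult_def)
qed

section \<open>Evaluation as a ring homomorphism\<close>

definition monomial_value :: "(nat \<Rightarrow> 'a::comm_ring_1) \<Rightarrow> (nat \<Rightarrow>\<^sub>0 nat) \<Rightarrow> 'a" where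
  "monomial_value a m = (\<Prod>v\<in>keys m. a v ^ lookup m v)"

lemma monomial_value_superset:
  assumes "finite S" "keys m \<subseteq> S"
  shows "monomial_value a m = (\<Prod>v\<in>S. a v ^ lookup m v)"
  unfolding monomial_value_def using assms
  by (intro prod.mono_neutral_left) (auto simp: in_keys_iff)

lemma monomial_value_add: "monomial_value a (m + m') = monomial_value a m * monomial_value a m'"
proof -
  let ?S = "keys m \<union> keys m'"
  have "keys (m + m') \<subseteq> ?S" by (rule keys_add)
  then show ?thesis
    by (simp add: monomial_value_superset[of ?S] lookup_add power_add prod.distrib)
qed

lemma mpoly_eval_superset:
  assumes "finite S" "keys p \<subseteq> S"
  shows "mpoly_eval a p = (\<Sum>m\<in>S. lookup p m * monomial_value a m)"
  unfolding mpoly_eval_def monomial_value_def using assms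
  by (intro sum.mono_neutral_left) (auto simp: in_keys_iff)

lemma mpoly_eval_add: "mpoly_eval a (p + q) = mpoly_eval a p + mpoly_eval a q"
proof -
  let ?S = "keys p \<union> keys q"
  have "keys (p + q) \<subseteq> ?S" by (rule keys_add)
  then show ?thesis
    by (simp add: mpoly_eval_superset[of ?S] lookup_add algebra_simps sum.distrib)
qed

lemma mpoly_eval_0 [simp]: "mpoly_eval a 0 = 0"
  by (simp add: mpoly_eval_def)

lemma mpoly_eval_sum: "mpoly_eval a (\<Sum>x\<in>X. f x) = (\<Sum>x\<in>X. mpoly_eval a (f x))"
  by (induction X rule: infinite_finite_induct) (auto simp: mpoly_eval_add)

lemma mpoly_eval_single: "mpoly_eval a (single m c) = c * monomial_value a m"
  by (subst mpoly_eval_superset[of "{m}"]) auto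

lemma mpoly_eval_mult: "mpoly_eval a (p * q) = mpoly_eval a p * mpoly_eval a q"
proof -
  have "p * q = (\<Sum>m\<in>keys p. \<Sum>m'\<in>keys q. single (m + m') (lookup p m * lookup q m'))"
    by (subst poly_mapping_sum_single[of p], subst poly_mapping_sum_single[of q])
      (simp add: sum_product mult_single)
  then have "mpoly_eval a (p * q)
      = (\<Sum>m\<in>keys p. lookup p m * monomial_value a m) * (\<Sum>m\<in>keys q. lookup q m * monomial_value a m)"
    by (simp add: mpoly_eval_sum mpoly_eval_single monomial_value_add sum_product mult_ac)
  then show ?thesis by (simp flip: mpoly_eval_superset)
qed

lemma mpoly_eval_var_poly: "mpoly_eval a (var_poly v p) = poly p (a v)"
proof -
  have "monomial_value a (single v k) = a v ^ k" for k
    by (subst monomial_value_superset[of "{v}"]) (auto split: if_splits)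
  then show ?thesis by (simp add: var_poly_def mpoly_eval_sum mpoly_eval_single poly_altdef)
qed

lemma mpoly_eval_abp_prod:
  "mpoly_eval a (abp_prod w xs i j) = mprod w (map (\<lambda>(v, M). eval_mat M (a v)) xs) i j"
proof (induction xs arbitrary: i j)
  case Nil
  have "mpoly_eval a 1 = 1"
    by (simp flip: single_one add: mpoly_eval_single monomial_value_def)
  then show ?case by simp
next
  case (Cons x xs)
  then show ?case
    by (cases x) (simp add: mat_mult_def mpoly_eval_sum mpoly_eval_mult mpoly_eval_var_poly eval_mat_def)
qed

section \<open>Interpolation\<close>

definition lagrange_basis :: "'a::field set \<Rightarrow> 'a \<Rightarrow> 'a poly" where
  "lagrange_basis S a = (\<Prod>b\<in>S - {a}. smult (1 / (a - b)) [:-b, 1:])"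

lemma poly_lagrange_basis:
  assumes "finite S" "a \<in> S" "b \<in> S"
  shows "poly (lagrange_basis S a) b = (if a = b then 1 else 0)"
proof (cases "a = b")
  case True
  have "poly (lagrange_basis S a) a = (\<Prod>c\<in>S - {a}. 1)"
    unfolding lagrange_basis_def poly_prod by (intro prod.cong) (auto simp: field_simps)
  with True show ?thesis by simp
next
  case False
  then show ?thesis using assms
    by (auto simp: lagrange_basis_def poly_prod intro!: prod_zero bexI[of _ b])
qed

lemma degree_lagrange_basis:
  assumes "finite S" "a \<in> S"
  shows "degree (lagrange_basis S a) < card S"
proof -
  have "degree (lagrange_basis S a) \<le> (\<Sum>b\<in>S - {a}. degree (smult (1 / (a - b)) [:-b, 1:]))"
    unfolding lagrange_basis_def
    by (rule order.trans[OF degree_prod_sum_le]) (use assms in \<open>simp_all only: o_def finite_Diff order_refl\<close>)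
  also have "\<dots> \<le> (\<Sum>b\<in>S - {a}. 1)"
    by (intro sum_mono) auto
  also have "\<dots> < card S"
    using assms by (simp add: card_gt_0_iff) (metis card_gt_0_iff diff_Suc_less empty_iff)
  finally show ?thesis .
qed

text \<open>Both sides have degree below \<open>card S\<close> and agree on
  \<open>S\<close>.\<close>

lemma lagrange_interpolation:
  fixes p :: "'a::field poly"
  assumes "finite S" "degree p < card S"
  shows "p = (\<Sum>a\<in>S. smult (poly p a) (lagrange_basis S a))"
proof (rule poly_eqI_degree[of S])
  fix x assume x: "x \<in> S"
  have "poly (\<Sum>a\<in>S. smult (poly p a) (lagrange_basis S a)) x
      = (\<Sum>a\<in>S. if a = x then poly p a else 0)"
    unfolding poly_sum using assms x by (intro sum.cong) (auto simp: poly_lagrange_basis)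
  then show "poly p x = poly (\<Sum>a\<in>S. smult (poly p a) (lagrange_basis S a)) x"
    using assms x by simp
next
  have "degree (\<Sum>a\<in>S. smult (poly p a) (lagrange_basis S a)) < card S"
    using assms by (intro degree_sum_less) (blast intro: le_less_trans[OF degree_smult_le degree_lagrange_basis], simp)
  then show "card S > degree (\<Sum>a\<in>S. smult (poly p a) (lagrange_basis S a))" .
qed (use assms in auto)

section \<open>Spans of matrices\<close>

text \<open>Matrices are functions on all of \<open>nat \<times> nat\<close>; cutting them off outside the
  \<open>w \<times> w\<close> block makes the ambient space \<open>w\<^sup>2\<close>-dimensional.\<close>

definition block :: "nat \<Rightarrow> (nat \<Rightarrow> nat \<Rightarrow> 'a::zero) \<Rightarrow> nat \<Rightarrow> nat \<Rightarrow> 'a" where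
  "block w A = (\<lambda>i j. if i < w \<and> j < w then A i j else 0)"

definition scale_mat :: "'a::comm_ring_1 \<Rightarrow> (nat \<Rightarrow> nat \<Rightarrow> 'a) \<Rightarrow> nat \<Rightarrow> nat \<Rightarrow> 'a" where
  "scale_mat c A = (\<lambda>i j. c * A i j)"

interpretation mat: vector_space "scale_mat :: 'a::field \<Rightarrow> _"
  by unfold_locales (auto simp: scale_mat_def fun_eq_iff algebra_simps)

lemma sum_mat_apply: "(\<Sum>x\<in>X. f x) i j = (\<Sum>x\<in>X. f x i (j::nat))" for f :: "_ \<Rightarrow> nat \<Rightarrow> nat \<Rightarrow> 'a::comm_ring_1"
  by (induction X rule: infinite_finite_induct) auto

lemma card_independent_blocks_le:
  assumes "mat.independent S" "S \<subseteq> range (block w)"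
  shows "finite S \<and> card S \<le> w ^ 2"
proof -
  \<comment> \<open>The matrix units: at most \<open>w ^ 2\<close> of them, and they span all
    cut-off matrices.\<close>
  define E :: "nat \<times> nat \<Rightarrow> nat \<Rightarrow> nat \<Rightarrow> 'a"
    where "E = (\<lambda>(k, l) i j. if i = k \<and> j = l then 1 else 0)"
  let ?I = "{..<w} \<times> {..<w}"
  have "block w A \<in> mat.span (E ` ?I)" for A :: "nat \<Rightarrow> nat \<Rightarrow> 'a"
  proof -
    have "block w A = (\<Sum>x\<in>?I. scale_mat (A (fst x) (snd x)) (E x))"
    proof (intro ext)
      fix i j
      have "(\<Sum>x\<in>?I. scale_mat (A (fst x) (snd x)) (E x)) i j
          = (\<Sum>x\<in>?I. if x = (i, j) then A i j else 0)"
        unfolding sum_mat_apply by (intro sum.cong) (auto simp: E_def scale_mat_def split: if_splits)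
      then show "block w A i j = (\<Sum>x\<in>?I. scale_mat (A (fst x) (snd x)) (E x)) i j"
        by (auto simp: block_def)
    qed
    moreover have "\<dots> \<in> mat.span (E ` ?I)"
      by (intro mat.span_sum mat.span_scale mat.span_base) auto
    ultimately show ?thesis by simp
  qed
  with assms have "S \<subseteq> mat.span (E ` ?I)" by auto
  then have "finite S \<and> card S \<le> card (E ` ?I)"
    by (intro mat.independent_span_bound assms) auto
  moreover have "card (E ` ?I) \<le> w ^ 2"
    using card_image_le[of ?I E] by (simp add: power2_eq_square)
  ultimately show ?thesis by auto
qed

text \<open>By Lagrange interpolation the value at any point is a fixed linear combination of the values at
  \<open>D + 1\<close> points, so a curve of degree at most \<open>D\<close> that leaves a subspace meets it in at most
  \<open>D\<close> points.\<close>

lemma card_curve_in_span_le: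
  fixes A :: "nat \<Rightarrow> nat \<Rightarrow> 'a::field poly"
  assumes deg: "\<And>i j. degree (A i j) \<le> D"
    and out: "block w (eval_mat A s) \<notin> mat.span U"
  shows "finite {s. block w (eval_mat A s) \<in> mat.span U}
       \<and> card {s. block w (eval_mat A s) \<in> mat.span U} \<le> D"
proof (rule ccontr)
  let ?B = "{s. block w (eval_mat A s) \<in> mat.span U}"
  assume *: "\<not> ?thesis"
  obtain S where S: "S \<subseteq> ?B" "finite S" "card S = Suc D"
  proof (cases "finite ?B")
    case True
    with * have "Suc D \<le> card ?B" by simp
    then show ?thesis using obtain_subset_with_card_n that True by (metis finite_subset)
  next
    case False
    then show ?thesis using infinite_arbitrarily_large that by metis
  qed
  have "block w (eval_mat A s) = (\<Sum>a\<in>S. scale_mat (poly (lagrange_basis S a) s) (block w (eval_mat A a)))"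
  proof (intro ext)
    fix i j
    have "degree (A i j) < card S" using deg S by (simp add: le_imp_less_Suc)
    then have "A i j = (\<Sum>a\<in>S. smult (poly (A i j) a) (lagrange_basis S a))"
      by (rule lagrange_interpolation[OF S(2)])
    from arg_cong[OF this, of "\<lambda>p. poly p s"]
    have "poly (A i j) s = (\<Sum>a\<in>S. poly (A i j) a * poly (lagrange_basis S a) s)"
      by (simp only: poly_sum poly_smult)
    then show "block w (eval_mat A s) i j
        = (\<Sum>a\<in>S. scale_mat (poly (lagrange_basis S a) s) (block w (eval_mat A a))) i j"
      unfolding sum_mat_apply by (auto simp: block_def eval_mat_def scale_mat_def mult.commute)
  qed
  also have "\<dots> \<in> mat.span U"
    using S by (intro mat.span_sum mat.span_scale) auto
  finally show False using out by simp
qed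

text \<open>Taking the coefficient of degree \<open>e\<close> in the Lagrange formula writes the
  coefficient matrix as a combination of values. In this way a non-zero coefficient leads to a point
  of non-vanishing.\<close>

lemma coeff_mat_in_span_eval:
  fixes A :: "nat \<Rightarrow> nat \<Rightarrow> 'a::field poly"
  assumes deg: "\<And>i j. degree (A i j) \<le> D" and S: "finite (S :: 'a set)" "D < card S"
  shows "block w (\<lambda>i j. coeff (A i j) e) \<in> mat.span ((\<lambda>s. block w (eval_mat A s)) ` UNIV)"
proof -
  have "block w (\<lambda>i j. coeff (A i j) e)
      = (\<Sum>a\<in>S. scale_mat (coeff (lagrange_basis S a) e) (block w (eval_mat A a)))"
  proof (intro ext)
    fix i j
    have "degree (A i j) < card S" using deg S by (meson le_less_trans)
    then have "A i j = (\<Sum>a\<in>S. smult (poly (A i j) a) (lagrange_basis S a))"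
      by (rule lagrange_interpolation[OF S(1)])
    from arg_cong[OF this, of "\<lambda>p. coeff p e"]
    have "coeff (A i j) e = (\<Sum>a\<in>S. poly (A i j) a * coeff (lagrange_basis S a) e)"
      by (simp only: coeff_sum coeff_smult)
    then show "block w (\<lambda>i j. coeff (A i j) e) i j
        = (\<Sum>a\<in>S. scale_mat (coeff (lagrange_basis S a) e) (block w (eval_mat A a))) i j"
      unfolding sum_mat_apply by (auto simp: block_def eval_mat_def scale_mat_def mult.commute)
  qed
  also have "\<dots> \<in> mat.span ((\<lambda>s. block w (eval_mat A s)) ` UNIV)"
    by (intro mat.span_sum mat.span_scale mat.span_base) auto
  finally show ?thesis .
qed

text \<open>The factors are replaced one at a time from the left. The product is linear in each
  factor, so if it vanished on all generators it would vanish on their span. The row vector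
  \<open>r\<close> is arbitrary because it absorbs the factors already replaced.\<close>

lemma row_mprod_nonzero_from_span:
  fixes Q :: "nat \<Rightarrow> nat \<Rightarrow> nat \<Rightarrow> 'a::field"
  assumes "distinct ts"
    and "\<And>t. t \<in> set ts \<Longrightarrow> block w (Q t) \<in> mat.span ((\<lambda>l. block w (P t l)) ` I)"
    and "(\<Sum>k<w. r k * mprod w (map Q ts) k j) \<noteq> 0"
  shows "\<exists>c. (\<forall>t\<in>set ts. c t \<in> I) \<and> (\<Sum>k<w. r k * mprod w (map (\<lambda>t. P t (c t)) ts) k j) \<noteq> 0"
  using assms
proof (induction ts arbitrary: r)
  case Nil
  then show ?case by auto
next
  case (Cons t ts)
  define \<phi> where "\<phi> = (\<lambda>A. \<Sum>l<w. (\<Sum>k<w. r k * A k l) * mprod w (map Q ts) l j)"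
  have assoc: "(\<Sum>k<w. r k * mprod w (A # As) k j) = (\<Sum>l<w. (\<Sum>k<w. r k * A k l) * mprod w As l j)"
    for A and As :: "(nat \<Rightarrow> nat \<Rightarrow> 'a) list"
  proof -
    have "(\<Sum>k<w. r k * mprod w (A # As) k j) = (\<Sum>k<w. \<Sum>l<w. r k * A k l * mprod w As l j)"
      by (simp add: mat_mult_def sum_distrib_left mult.assoc)
    also have "\<dots> = (\<Sum>l<w. \<Sum>k<w. r k * A k l * mprod w As l j)"
      by (rule sum.swap)
    finally show ?thesis by (simp add: sum_distrib_right)
  qed
  have block: "\<phi> (block w A) = \<phi> A" for A
    by (simp add: \<phi>_def block_def)
  have "\<phi> (block w (Q t)) \<noteq> 0"
    unfolding block using Cons.prems(3) by (simp add: \<phi>_def flip: assoc)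
  moreover have "\<phi> A = 0" if "A \<in> mat.span ((\<lambda>l. block w (P t l)) ` I)"
    "\<And>l. l \<in> I \<Longrightarrow> \<phi> (block w (P t l)) = 0" for A
    using that(1)
  proof (induction rule: mat.span_induct_alt)
    case base
    then show ?case by (simp add: \<phi>_def)
  next
    case (step c x y)
    have "\<phi> (scale_mat c x + y) = c * \<phi> x + \<phi> y"
      by (simp add: \<phi>_def scale_mat_def algebra_simps sum.distrib sum_distrib_left sum_distrib_right)
    moreover have "\<phi> x = 0" using step that(2) by blast
    ultimately show ?case using step by (metis add.right_neutral mult_zero_right)
  qed
  ultimately obtain l where l: "l \<in> I" "\<phi> (P t l) \<noteq> 0"
    using Cons.prems(2)[of t] block by force
  then obtain c where c: "\<forall>t\<in>set ts. c t \<in> I"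
    "(\<Sum>m<w. (\<Sum>k<w. r k * P t l k m) * mprod w (map (\<lambda>t. P t (c t)) ts) m j) \<noteq> 0"
    using Cons.IH[of "\<lambda>m. \<Sum>k<w. r k * P t l k m"] Cons.prems unfolding \<phi>_def by auto
  \<comment> \<open>By distinctness \<open>t\<close> does not recur in \<open>ts\<close>, so
    recording the choice \<open>l\<close> for \<open>t\<close> leaves the later choices
    intact.\<close>
  have "map (\<lambda>u. P u ((c(t := l)) u)) ts = map (\<lambda>t. P t (c t)) ts"
    using Cons.prems(1) by auto
  then have "(\<Sum>k<w. r k * mprod w (map (\<lambda>u. P u ((c(t := l)) u)) (t # ts)) k j) \<noteq> 0"
    using c(2) unfolding list.map assoc by (simp only: fun_upd_same not_False_eq_True)
  with c(1) l(1) show ?case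
    by (intro exI[of _ "c(t := l)"]) auto
qed

lemma mprod_nonzero_from_span:
  fixes Q :: "nat \<Rightarrow> nat \<Rightarrow> nat \<Rightarrow> 'a::field"
  assumes "distinct ts" "i < w"
    and "\<And>t. t \<in> set ts \<Longrightarrow> block w (Q t) \<in> mat.span ((\<lambda>l. block w (P t l)) ` I)"
    and "mprod w (map Q ts) i j \<noteq> 0"
  obtains c where "\<And>t. t \<in> set ts \<Longrightarrow> c t \<in> I" "mprod w (map (\<lambda>t. P t (c t)) ts) i j \<noteq> 0"
proof -
  let ?r = "\<lambda>k. if k = i then 1 else 0 :: 'a"
  have row: "(\<Sum>k<w. ?r k * A k j) = A i j" for A :: "nat \<Rightarrow> nat \<Rightarrow> 'a"
  proof -
    have "(\<Sum>k<w. ?r k * A k j) = (\<Sum>k<w. if k = i then A k j else 0)"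
      by (intro sum.cong) auto
    with \<open>i < w\<close> show ?thesis by simp
  qed
  show ?thesis
    using row_mprod_nonzero_from_span[of ts w Q P I ?r j] assms that unfolding row by blast
qed

text \<open>Greedy choice of a sequence of pairs of points: as long as the products at the chosen points do
  not span all products for some \<open>t\<close>, all but few pairs enlarge these spans simultaneously, and
  no span can be enlarged more than \<open>w\<^sup>2\<close> times.\<close>

lemma product_spanning_points:
  fixes A B :: "nat \<Rightarrow> nat \<Rightarrow> nat \<Rightarrow> 'a::field poly" and w m :: nat
  assumes degA: "\<And>t i j. degree (A t i j) \<le> D" and degB: "\<And>t i j. degree (B t i j) \<le> D"
    and avail: "\<And>S::'a set. finite S \<Longrightarrow> card S \<le> m * D \<Longrightarrow> \<exists>s. s \<notin> S"
  defines "P \<equiv> \<lambda>t s u. block w (mat_mult w (eval_mat (A t) s) (eval_mat (B t) u))"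
  shows "\<exists>a b. \<forall>t<m. \<forall>s u. P t s u \<in> mat.span ((\<lambda>l. P t (a l) (b l)) ` {..<w ^ 2})"
proof -
  \<comment> \<open>With one argument fixed, the product is a curve of degree at most
    \<open>D\<close> in the other one, so each argument has few bad values.\<close>
  have curveA: "P t s u = block w (eval_mat (\<lambda>i j. \<Sum>k<w. smult (poly (B t k j) u) (A t i k)) s)" for t s u
    by (simp add: P_def mat_mult_def eval_mat_def poly_sum mult.commute)
  have curveB: "P t s u = block w (eval_mat (\<lambda>i j. \<Sum>k<w. smult (poly (A t i k) s) (B t k j)) u)" for t s u
    by (simp add: P_def mat_mult_def eval_mat_def poly_sum)
  have few: "\<exists>s. \<forall>t\<in>T. s \<notin> X t"
    if "T \<subseteq> {..<m}" "\<And>t. t \<in> T \<Longrightarrow> finite (X t) \<and> card (X t) \<le> D" for T and X :: "nat \<Rightarrow> 'a set"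
  proof -
    have "finite T" using that(1) finite_subset by blast
    have "card T \<le> m" using card_mono[OF _ that(1)] by simp
    have "card (\<Union>t\<in>T. X t) \<le> (\<Sum>t\<in>T. card (X t))"
      by (rule card_UN_le) fact
    also have "\<dots> \<le> card T * D"
      using that(2) sum_bounded_above[of T "\<lambda>t. card (X t)" D] by simp
    also have "\<dots> \<le> m * D" using \<open>card T \<le> m\<close> by simp
    finally show ?thesis using avail[of "\<Union>t\<in>T. X t"] that(2) \<open>finite T\<close> by auto
  qed
  have extend: "\<exists>s u. \<forall>t\<in>T. P t s u \<notin> mat.span (U t)"
    if T: "T \<subseteq> {..<m}" and "\<And>t. t \<in> T \<Longrightarrow> \<exists>s u. P t s u \<notin> mat.span (U t)" for T U
  proof -
    from that(2) obtain s0 u0 where out: "\<And>t. t \<in> T \<Longrightarrow> P t (s0 t) (u0 t) \<notin> mat.span (U t)"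
      by metis
    \<comment> \<open>The arguments are made common to all \<open>t\<close> one after the other:
      first \<open>s\<close>, with the second argument still depending on \<open>t\<close>, and then
      \<open>u\<close> for this \<open>s\<close>.\<close>
    have "\<exists>s. \<forall>t\<in>T. s \<notin> {s. P t s (u0 t) \<in> mat.span (U t)}"
      using out unfolding curveA
      by (intro few[OF T] card_curve_in_span_le degree_sum_le)
        (auto intro!: order.trans[OF degree_smult_le] degA)
    then obtain s where s: "\<And>t. t \<in> T \<Longrightarrow> P t s (u0 t) \<notin> mat.span (U t)" by auto
    have "\<exists>u. \<forall>t\<in>T. u \<notin> {u. P t s u \<in> mat.span (U t)}"
      using s unfolding curveB
      by (intro few[OF T] card_curve_in_span_le degree_sum_le)
        (auto intro!: order.trans[OF degree_smult_le] degB)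
    then show ?thesis by auto
  qed
  let ?V = "\<lambda>a b t L. (\<lambda>l. P t (a l) (b l)) ` {..<L}"
  \<comment> \<open>For each \<open>t\<close> separately, the first \<open>L\<close> pairs either
    span already or have contributed \<open>L\<close> independent products.\<close>
  have greedy: "\<exists>a b. \<forall>t<m. (\<forall>s u. P t s u \<in> mat.span (?V a b t L))
      \<or> (mat.independent (?V a b t L) \<and> card (?V a b t L) = L)" for L
  proof (induction L)
    case 0
    show ?case by (simp add: mat.independent_empty)
  next
    case (Suc L)
    then obtain a b where ab: "\<And>t. t < m \<Longrightarrow> (\<forall>s u. P t s u \<in> mat.span (?V a b t L))
      \<or> (mat.independent (?V a b t L) \<and> card (?V a b t L) = L)" by blast
    define T where "T = {t. t < m \<and> \<not> (\<forall>s u. P t s u \<in> mat.span (?V a b t L))}"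
    obtain s u where su: "\<And>t. t \<in> T \<Longrightarrow> P t s u \<notin> mat.span (?V a b t L)"
      using extend[of T "\<lambda>t. ?V a b t L"] unfolding T_def by blast
    have V: "?V (a(L := s)) (b(L := u)) t (Suc L) = insert (P t s u) (?V a b t L)" for t
      unfolding lessThan_Suc by (auto intro!: image_cong)
    show ?case
    proof (intro exI allI impI)
      fix t assume t: "t < m"
      show "(\<forall>s' u'. P t s' u' \<in> mat.span (?V (a(L := s)) (b(L := u)) t (Suc L)))
        \<or> (mat.independent (?V (a(L := s)) (b(L := u)) t (Suc L))
           \<and> card (?V (a(L := s)) (b(L := u)) t (Suc L)) = Suc L)"
      proof (cases "t \<in> T")
        case True
        then have "mat.independent (?V a b t L) \<and> card (?V a b t L) = L"
          using ab[OF t] by (auto simp: T_def)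
        moreover have "P t s u \<notin> ?V a b t L"
          by (rule contra_subsetD[OF mat.span_superset su[OF True]])
        ultimately show ?thesis
          using mat.independent_insertI[OF su[OF True]] unfolding V by simp
      next
        case False
        then have "\<forall>s' u'. P t s' u' \<in> mat.span (?V a b t L)"
          using t by (auto simp: T_def)
        then show ?thesis
          unfolding V by (intro disjI1 allI subsetD[OF mat.span_mono[OF subset_insertI]]) simp
      qed
    qed
  qed
  obtain a b where ab: "\<And>t. t < m \<Longrightarrow> (\<forall>s u. P t s u \<in> mat.span (?V a b t (w ^ 2)))
      \<or> (mat.independent (?V a b t (w ^ 2)) \<and> card (?V a b t (w ^ 2)) = w ^ 2)"
    using greedy[of "w ^ 2"] by blast
  \<comment> \<open>A product outside the span would extend \<open>w ^ 2\<close> independent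
    matrices to \<open>w ^ 2 + 1\<close> of them.\<close>
  have "P t s u \<in> mat.span (?V a b t (w ^ 2))" if t: "t < m" for t s u
  proof (rule ccontr)
    assume out: "P t s u \<notin> mat.span (?V a b t (w ^ 2))"
    then have ind: "mat.independent (?V a b t (w ^ 2))" "card (?V a b t (w ^ 2)) = w ^ 2"
      using ab[OF t] by auto
    have "P t s u \<notin> ?V a b t (w ^ 2)" by (rule contra_subsetD[OF mat.span_superset out])
    then have "card (insert (P t s u) (?V a b t (w ^ 2))) = Suc (w ^ 2)"
      using ind(2) by simp
    moreover have "mat.independent (insert (P t s u) (?V a b t (w ^ 2)))"
      using out ind(1) by (rule mat.independent_insertI)
    moreover have "insert (P t s u) (?V a b t (w ^ 2)) \<subseteq> range (block w)"
      by (auto simp: P_def)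
    ultimately show False using card_independent_blocks_le[of "insert (P t s u) (?V a b t (w ^ 2))" w] by simp
  qed
  then show ?thesis by blast
qed

section \<open>Merging neighbouring blocks\<close>

lemma concat_blocks: "concat (map (\<lambda>t. [t * K..<Suc t * K]) [0..<m]) = [0..<m * K]"
proof (induction m)
  case (Suc m)
  have "[0..<Suc m * K] = [0..<m * K] @ [m * K..<Suc m * K]"
    using upt_add_eq_append[of 0 "m * K" K] by (simp add: add.commute)
  with Suc show ?case by simp
qed simp

lemma mprod_blocks:
  assumes "i < w"
  shows "mprod w (map h [0..<m * K]) i j
    = mprod w (map (\<lambda>t. mprod w (map h [t * K..<Suc t * K])) [0..<m]) i j"
proof -
  have "map h [0..<m * K] = concat (map (\<lambda>t. map h [t * K..<Suc t * K]) [0..<m])"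
    unfolding concat_blocks[symmetric] map_concat by (simp add: o_def)
  then show ?thesis by (simp only: mprod_concat[OF assms] map_map o_def)
qed

lemma mprod_double_block:
  fixes t K :: nat
  assumes "i < w"
  shows "mprod w (map h [t * (2 * K)..<Suc t * (2 * K)]) i j
    = mat_mult w (mprod w (map h [2 * t * K..<Suc (2 * t) * K]))
        (mprod w (map h [Suc (2 * t) * K..<Suc (Suc (2 * t)) * K])) i j"
proof -
  have "[t * (2 * K)..<Suc t * (2 * K)] = [2 * t * K..<Suc (2 * t) * K] @ [Suc (2 * t) * K..<Suc (Suc (2 * t)) * K]"
    using upt_add_eq_append[of "2 * t * K" "Suc (2 * t) * K" K] by (simp add: algebra_simps)
  then show ?thesis by (simp add: mprod_append[OF assms] mat_mult_def)
qed

text \<open>Position \<open>p\<close> carries the curve \<open>x p\<close>, and the positions of one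
  block of length \<open>2 ^ k\<close> share an argument given by \<open>v\<close>. After merging,
  the arguments come from a list \<open>\<phi>\<close> of \<open>w ^ 2\<close> pairs common to all
  blocks, and \<open>c\<close> is the choice made by each merged block.\<close>

lemma merge_level:
  fixes M :: "nat \<Rightarrow> nat \<Rightarrow> nat \<Rightarrow> 'a::field poly" and x :: "nat \<Rightarrow> 'a poly"
  assumes w: "w \<ge> 1" and k: "k < n"
    and degM: "\<And>p i j. degree (M p i j) \<le> d" and degx: "\<And>p. degree (x p) \<le> W"
    and avail: "\<And>S::'a set. finite S \<Longrightarrow> card S \<le> 2 ^ n * d * W \<Longrightarrow> \<exists>s. s \<notin> S"
    and nz: "mprod w (map (\<lambda>p. eval_mat (M p) (poly (x p) (v (p div 2 ^ k)))) [0..<2 ^ n]) 0 0 \<noteq> 0"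
  shows "\<exists>\<phi> c. (\<forall>t<2 ^ (n - Suc k). c t < w ^ 2) \<and>
    mprod w (map (\<lambda>p. eval_mat (M p) (poly (x p) (\<phi> (bit p k) (c (p div 2 ^ Suc k))))) [0..<2 ^ n]) 0 0 \<noteq> 0"
proof -
  let ?K = "2 ^ k :: nat" and ?m = "2 ^ (n - Suc k) :: nat"
  \<comment> \<open>The matrix of block \<open>q\<close> as a polynomial in its argument; each of
    its \<open>2 ^ k\<close> factors has degree at most \<open>d * W\<close>, which gives
    \<open>D\<close>.\<close>
  define Q where "Q q = mprod w (map (\<lambda>p i j. pcompose (M p i j) (x p)) [q * ?K..<Suc q * ?K])" for q
  define D where "D = ?K * (d * W)"
  have size: "?m * (2 * ?K) = 2 ^ n"
    using k by (simp flip: power_Suc power_add)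
  have degQ: "degree (Q q i j) \<le> D" for q i j
  proof -
    have "degree (pcompose (M p i j) (x p)) \<le> d * W" for p i j
      using degree_pcompose_le degM degx by (meson mult_le_mono order.trans)
    then show ?thesis
      unfolding Q_def D_def by (intro order.trans[OF degree_mprod_le]) auto
  qed
  have evalQ: "eval_mat (Q q) s = mprod w (map (\<lambda>p. eval_mat (M p) (poly (x p) s)) [q * ?K..<Suc q * ?K])" for q s
    by (intro ext, simp add: Q_def eval_mat_def[of "mprod _ _"] poly_mprod o_def)
      (simp add: eval_mat_def poly_pcompose)
  have small: "?m * D \<le> 2 ^ n * d * W"
  proof -
    have "?m * ?K \<le> 2 ^ n" unfolding size[symmetric] by simp
    then have "?m * ?K * (d * W) \<le> 2 ^ n * (d * W)" by (rule mult_le_mono1)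
    then show ?thesis unfolding D_def by (simp only: mult.assoc)
  qed
  have divK: "p div ?K = q" if "p \<in> set [q * ?K..<Suc q * ?K]" for p q
    using that by (intro div_nat_eqI) (auto simp: algebra_simps)
  have merged: "mprod w (map (\<lambda>p. eval_mat (M p) (poly (x p) (u (p div ?K)))) [0..<2 ^ n]) 0 0
    = mprod w (map (\<lambda>t. mat_mult w (eval_mat (Q (2 * t)) (u (2 * t))) (eval_mat (Q (Suc (2 * t))) (u (Suc (2 * t)))))
        [0..<?m]) 0 0" for u
  proof -
    let ?h = "\<lambda>p. eval_mat (M p) (poly (x p) (u (p div ?K)))"
    have block: "mprod w (map ?h [q * ?K..<Suc q * ?K]) = eval_mat (Q q) (u q)" for q
      unfolding evalQ using divK[of _ q] by (intro arg_cong[where f = "mprod w"] map_cong) auto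
    show ?thesis
      unfolding size[symmetric] using w
      by (subst mprod_blocks, simp, intro mprod_cong)
        (simp_all only: mprod_double_block block)
  qed
  define P where "P t s u = mat_mult w (eval_mat (Q (2 * t)) s) (eval_mat (Q (Suc (2 * t))) u)" for t s u
  obtain a b where ab: "\<And>t s u. t < ?m \<Longrightarrow> block w (P t s u)
      \<in> mat.span ((\<lambda>l. block w (P t (a l) (b l))) ` {..<w ^ 2})"
    using product_spanning_points[of "\<lambda>t. Q (2 * t)" D "\<lambda>t. Q (Suc (2 * t))" ?m w] degQ avail small
    unfolding P_def by (meson order.trans)
  \<comment> \<open>The products at the old arguments \<open>v\<close> lie in the spans of the
    chosen ones, so non-vanishing passes to some choice of pairs.\<close>
  obtain c where c: "\<And>t. t \<in> set [0..<?m] \<Longrightarrow> c t \<in> {..<w ^ 2}"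
    "mprod w (map (\<lambda>t. P t (a (c t)) (b (c t))) [0..<?m]) 0 0 \<noteq> 0"
  proof (rule mprod_nonzero_from_span[of "[0..<?m]" 0 w "\<lambda>t. P t (v (2 * t)) (v (Suc (2 * t)))"
        "\<lambda>t l. P t (a l) (b l)" "{..<w ^ 2}" 0])
    show "mprod w (map (\<lambda>t. P t (v (2 * t)) (v (Suc (2 * t)))) [0..<?m]) 0 0 \<noteq> 0"
      using nz unfolding merged P_def .
  qed (use w ab in auto)
  \<comment> \<open>Bit \<open>k\<close> of a position tells in which half of the merged block it
    lies: the left half takes its argument from \<open>a\<close>, the right half from
    \<open>b\<close>.\<close>
  define \<phi> where "\<phi> = (\<lambda>\<beta> l. if \<beta> then b l else a l)"
  define u where "u q = \<phi> (odd q) (c (q div 2))" for q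
  have "P t (a (c t)) (b (c t)) = mat_mult w (eval_mat (Q (2 * t)) (u (2 * t))) (eval_mat (Q (Suc (2 * t))) (u (Suc (2 * t))))" for t
    by (simp add: P_def u_def \<phi>_def)
  with c(2) have "mprod w (map (\<lambda>p. eval_mat (M p) (poly (x p) (u (p div ?K)))) [0..<2 ^ n]) 0 0 \<noteq> 0"
    unfolding merged by simp
  moreover have "u (p div ?K) = \<phi> (bit p k) (c (p div 2 ^ Suc k))" for p
    by (simp add: u_def bit_iff_odd div_mult2_eq mult.commute[of 2])
  ultimately show ?thesis using c(1) by (intro exI[of _ \<phi>] exI[of _ c]) auto
qed

text \<open>The value at position \<open>p\<close> of the \<open>l\<close>-th chosen point after \<open>k\<close> merges. It only depends on the
  lowest \<open>k\<close> bits of \<open>p\<close>, so it need not be reduced modulo the block size.\<close>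

definition point :: "nat \<Rightarrow> (nat \<Rightarrow> bool \<Rightarrow> nat \<Rightarrow> nat \<Rightarrow> 'a::comm_ring_1) \<Rightarrow> nat \<Rightarrow> nat \<Rightarrow> nat \<Rightarrow> 'a" where
  "point W T k l p = mprod W (map (\<lambda>i. T i (bit p i)) (rev [0..<k])) l 0"

lemma point_cong:
  assumes "\<And>i. i < k \<Longrightarrow> T i = T' i"
  shows "point W T k l p = point W T' k l p"
  unfolding point_def using assms by (intro arg_cong[where f = "\<lambda>As. mprod W As l 0"] map_cong) auto

lemma point_Suc: "point W T (Suc k) l p = (\<Sum>m<W. T k (bit p k) l m * point W T k m p)"
  by (simp add: point_def mat_mult_def)

text \<open>By induction on the level. The index \<open>c t\<close> chosen by a block is encoded as
  the node \<open>\<beta> (c t)\<close>, and the curves interpolating the current points at these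
  nodes are the input of the next merge.\<close>

lemma merged_points_nonzero:
  fixes M :: "nat \<Rightarrow> nat \<Rightarrow> nat \<Rightarrow> 'a::field poly"
  assumes w: "w \<ge> 1" and k: "k < n"
    and degM: "\<And>p i j. degree (M p i j) \<le> d"
    and avail: "\<And>S::'a set. finite S \<Longrightarrow> card S \<le> 2 ^ n * d * w ^ 2 \<Longrightarrow> \<exists>s. s \<notin> S"
    and \<beta>: "inj_on (\<beta> :: nat \<Rightarrow> 'a) {..<w ^ 2}"
    and nz: "mprod w (map (\<lambda>p. eval_mat (M p) (v p)) [0..<2 ^ n]) 0 0 \<noteq> 0"
  shows "\<exists>T c. (\<forall>t<2 ^ (n - Suc k). c t < w ^ 2) \<and>
    mprod w (map (\<lambda>p. eval_mat (M p) (point (w ^ 2) T (Suc k) (c (p div 2 ^ Suc k)) p)) [0..<2 ^ n]) 0 0 \<noteq> 0"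
  using k
proof (induction k)
  case 0
  have W: "0 < w ^ 2" using w by simp
  \<comment> \<open>Before the first merge each position is a block of its own, with the identity
    polynomial as its curve.\<close>
  have "mprod w (map (\<lambda>p. eval_mat (M p) (poly [:0, 1:] (v (p div 2 ^ 0)))) [0..<2 ^ n]) 0 0 \<noteq> 0"
    using nz by simp
  then have "\<exists>\<phi> c. (\<forall>t<2 ^ (n - Suc 0). c t < w ^ 2) \<and>
    mprod w (map (\<lambda>p. eval_mat (M p) (poly [:0, 1:] (\<phi> (bit p 0) (c (p div 2 ^ Suc 0))))) [0..<2 ^ n]) 0 0 \<noteq> 0"
    using w 0 degM avail W by (intro merge_level[where d = d and W = "w ^ 2"]) auto
  then obtain \<phi> c where c: "\<forall>t<2 ^ (n - Suc 0). c t < w ^ 2"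
    "mprod w (map (\<lambda>p. eval_mat (M p) (poly [:0, 1:] (\<phi> (bit p 0) (c (p div 2 ^ Suc 0))))) [0..<2 ^ n]) 0 0 \<noteq> 0"
    by blast
  \<comment> \<open>The product in \<open>point\<close> ends with column 0 of the identity matrix,
    so at the lowest level only column 0 of \<open>T\<close> counts.\<close>
  define T :: "nat \<Rightarrow> bool \<Rightarrow> nat \<Rightarrow> nat \<Rightarrow> 'a" where "T = (\<lambda>_ b l _. \<phi> b l)"
  have "point (w ^ 2) T (Suc 0) l p = \<phi> (bit p 0) l" for l p
  proof -
    have "point (w ^ 2) T (Suc 0) l p = (\<Sum>m<w ^ 2. if m = 0 then \<phi> (bit p 0) l else 0)"
      unfolding point_Suc by (intro sum.cong) (auto simp: T_def point_def)
    with W show ?thesis by simp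
  qed
  with c show ?case by (intro exI[of _ T] exI[of _ c]) simp
next
  case (Suc k)
  then obtain T c where c: "\<And>t. t < 2 ^ (n - Suc k) \<Longrightarrow> c t < w ^ 2"
    "mprod w (map (\<lambda>p. eval_mat (M p) (point (w ^ 2) T (Suc k) (c (p div 2 ^ Suc k)) p)) [0..<2 ^ n]) 0 0 \<noteq> 0"
    by auto
  define L where "L l = lagrange_basis (\<beta> ` {..<w ^ 2}) (\<beta> l)" for l
  have L: "poly (L l) (\<beta> m) = (if l = m then 1 else 0)" if "l < w ^ 2" "m < w ^ 2" for l m
    unfolding L_def using that \<beta> by (subst poly_lagrange_basis) (auto simp: inj_on_def)
  have degL: "degree (L l) \<le> w ^ 2" if "l < w ^ 2" for l
    using degree_lagrange_basis[of "\<beta> ` {..<w ^ 2}" "\<beta> l"] that card_image[OF \<beta>] by (simp add: L_def)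
  define x where "x p = (\<Sum>m<w ^ 2. smult (point (w ^ 2) T (Suc k) m p) (L m))" for p
  have degx: "degree (x p) \<le> w ^ 2" for p
    unfolding x_def by (intro degree_sum_le) (auto intro: degL)
  have x\<beta>: "poly (x p) (\<beta> l) = point (w ^ 2) T (Suc k) l p" if "l < w ^ 2" for p l
  proof -
    have "poly (x p) (\<beta> l) = (\<Sum>m<w ^ 2. if m = l then point (w ^ 2) T (Suc k) m p else 0)"
      unfolding x_def poly_sum using that by (intro sum.cong) (auto simp: L)
    with that show ?thesis by simp
  qed
  have "p div 2 ^ Suc k < 2 ^ (n - Suc k)" if "p < 2 ^ n" for p :: nat
    using that Suc.prems by (intro less_mult_imp_div_less) (simp flip: power_add power_Suc)
  then have "map (\<lambda>p. eval_mat (M p) (point (w ^ 2) T (Suc k) (c (p div 2 ^ Suc k)) p)) [0..<2 ^ n]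
    = map (\<lambda>p. eval_mat (M p) (poly (x p) ((\<lambda>t. \<beta> (c t)) (p div 2 ^ Suc k)))) [0..<2 ^ n]"
    by (intro map_cong refl) (simp add: x\<beta> c(1) del: power_Suc)
  with c(2) have nz': "mprod w (map (\<lambda>p. eval_mat (M p) (poly (x p) ((\<lambda>t. \<beta> (c t)) (p div 2 ^ Suc k)))) [0..<2 ^ n]) 0 0 \<noteq> 0"
    by (simp only: not_False_eq_True)
  have "\<exists>\<phi> c'. (\<forall>t<2 ^ (n - Suc (Suc k)). c' t < w ^ 2) \<and>
    mprod w (map (\<lambda>p. eval_mat (M p) (poly (x p) (\<phi> (bit p (Suc k)) (c' (p div 2 ^ Suc (Suc k)))))) [0..<2 ^ n]) 0 0 \<noteq> 0"
    by (rule merge_level[where v = "\<lambda>t. \<beta> (c t)", OF w Suc.prems degM degx avail nz'])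
  then obtain \<phi> c' where c': "\<forall>t<2 ^ (n - Suc (Suc k)). c' t < w ^ 2"
    "mprod w (map (\<lambda>p. eval_mat (M p) (poly (x p) (\<phi> (bit p (Suc k)) (c' (p div 2 ^ Suc (Suc k)))))) [0..<2 ^ n]) 0 0 \<noteq> 0"
    by blast
  \<comment> \<open>Row \<open>l\<close> holds the Lagrange weights at \<open>\<phi> b l\<close>, so
    multiplying the vector of old points by this matrix evaluates the interpolating curve
    there.\<close>
  define T' where "T' = T(Suc k := \<lambda>b l m. poly (L m) (\<phi> b l))"
  have "point (w ^ 2) T' (Suc (Suc k)) l p = poly (x p) (\<phi> (bit p (Suc k)) l)" for l p
  proof -
    have "point (w ^ 2) T' (Suc k) m p = point (w ^ 2) T (Suc k) m p" for m
      by (rule point_cong) (simp add: T'_def)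
    then show ?thesis
      by (subst point_Suc) (simp add: T'_def x_def poly_sum mult.commute)
  qed
  with c' show ?case by (intro exI[of _ T'] exI[of _ c']) simp
qed

section \<open>Monomial-compatible orderings\<close>

text \<open>Reversing the summation gives a binary expansion with the least significant bit first,
  from which the bits of the rank can be read off.\<close>

lemma mc_rank_eq_horner_sum:
  "mc_rank n \<sigma> j = horner_sum of_bool 2 (map (\<lambda>q. bit j (\<sigma> (n - Suc q))) [0..<n])"
proof -
  have "mc_rank n \<sigma> j = (\<Sum>i<n. of_bool (bit j (\<sigma> i)) * 2 ^ (n - Suc i))"
    unfolding mc_rank_def by (intro sum.cong) auto
  also have "\<dots> = (\<Sum>q<n. of_bool (bit j (\<sigma> (n - Suc q))) * 2 ^ (n - Suc (n - Suc q)))"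
    by (rule sum.nat_diff_reindex[symmetric])
  also have "\<dots> = (\<Sum>q<n. of_bool (bit j (\<sigma> (n - Suc q))) * 2 ^ q)"
    by (intro sum.cong) auto
  finally show ?thesis by (simp add: horner_sum_eq_sum atLeast0LessThan)
qed

lemma bit_mc_rank: "q < n \<Longrightarrow> bit (mc_rank n \<sigma> j) q \<longleftrightarrow> bit j (\<sigma> (n - Suc q))"
  unfolding mc_rank_eq_horner_sum bit_horner_sum_bit_iff by simp

text \<open>The rank determines all \<open>n\<close> bits of \<open>j\<close>, as
  \<open>\<sigma>\<close> is onto; an injective self-map of a finite set is bijective.\<close>

lemma bij_betw_mc_rank:
  assumes "bij_betw \<sigma> {..<n} {..<n}"
  shows "bij_betw (mc_rank n \<sigma>) {..<2 ^ n} {..<2 ^ n}"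
proof -
  have "j = j'" if "j < 2 ^ n" "j' < 2 ^ n" "mc_rank n \<sigma> j = mc_rank n \<sigma> j'" for j j'
  proof -
    have "bit j q = bit j' q" if q: "q < n" for q
    proof -
      obtain i where i: "i < n" "\<sigma> i = q"
        using assms q unfolding bij_betw_def by (metis imageE lessThan_iff)
      then show ?thesis
        using bit_mc_rank[of "n - Suc i" n \<sigma> j] bit_mc_rank[of "n - Suc i" n \<sigma> j']
          \<open>mc_rank n \<sigma> j = mc_rank n \<sigma> j'\<close> by auto
    qed
    then have "take_bit n j = take_bit n j'"
      by (intro bit_eqI) (auto simp: bit_take_bit_iff)
    with that show ?thesis by (simp add: take_bit_nat_eq_self)
  qed
  then have "inj_on (mc_rank n \<sigma>) {..<2 ^ n}" by (auto simp: inj_on_def)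
  moreover have "mc_rank n \<sigma> ` {..<2 ^ n} \<subseteq> {..<2 ^ n}"
    unfolding mc_rank_eq_horner_sum
    using horner_sum_of_bool_2_less[where 'a = nat] by (auto simp: image_subset_iff) (metis length_map length_upt minus_nat.diff_0)
  ultimately show ?thesis
    by (metis bij_betw_def endo_inj_surj finite_lessThan)
qed

lemma lookup_ml_monomial: "lookup (ml_monomial n j) i = of_bool (i < n \<and> bit j i)"
  unfolding ml_monomial_def lookup_sum by (simp add: lookup_single when_def)

section \<open>The succinct hitting set\<close>

lemma zip_map_upt: "length Ms = L \<Longrightarrow> zip (map ord [0..<L]) Ms = map (\<lambda>p. (ord p, Ms ! p)) [0..<L]"
  by (intro nth_equalityI) auto

lemma lookup_abp_prod_map:
  assumes "inj_on ord {..<L}"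
  shows "lookup (abp_prod w (map (\<lambda>p. (ord p, M p)) [0..<L]) i j) m =
    (if keys m \<subseteq> ord ` {..<L} then mprod w (map (\<lambda>p i j. coeff (M p i j) (lookup m (ord p))) [0..<L]) i j else 0)"
proof -
  let ?xs = "map (\<lambda>p. (ord p, M p)) [0..<L]"
  have "distinct (map fst ?xs)"
    using assms by (simp add: distinct_map o_def lessThan_atLeast0)
  moreover have "fst ` set ?xs = ord ` {..<L}" by force
  ultimately show ?thesis by (simp only: lookup_abp_prod map_map o_def prod.case)
qed

text \<open>Individual degree at most \<open>d\<close> is assumed of the polynomial only; the entries of the matrices
  may have higher degree as long as these contributions cancel.\<close>

lemma roABP_computes_bounded_degree:
  assumes "roABP_computes w L ord F" "ind_degree_le d F" and inj: "inj_on ord {..<L}"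
  obtains M where "F = abp_prod w (map (\<lambda>p. (ord p, M p)) [0..<L]) 0 0"
    "\<And>p i j. degree (M p i j) \<le> d"
proof -
  obtain Ms where Ms: "length Ms = L" and "F = abp_prod w (zip (map ord [0..<L]) Ms) 0 0"
    using assms(1) unfolding roABP_computes_def by blast
  then have F: "F = abp_prod w (map (\<lambda>p. (ord p, Ms ! p)) [0..<L]) 0 0"
    by (simp add: zip_map_upt)
  \<comment> \<open>Truncation at degree \<open>d\<close> changes no coefficient of
    \<open>F\<close>: a monomial with a larger exponent has coefficient 0 in \<open>F\<close> and
    meets a zero matrix in the truncated product, and the other monomials see the same coefficients
    as before.\<close>
  define M where "M p i j = poly_cutoff (Suc d) ((Ms ! p) i j)" for p i j
  have "lookup F m = lookup (abp_prod w (map (\<lambda>p. (ord p, M p)) [0..<L]) 0 0) m" for m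
  proof (cases "\<exists>p<L. lookup m (ord p) > d")
    case True
    then obtain p where p: "p < L" "lookup m (ord p) > d" by blast
    then have "m \<notin> keys F" using assms(2) unfolding ind_degree_le_def by (meson not_le)
    moreover have "mprod w (map (\<lambda>p i j. coeff (M p i j) (lookup m (ord p))) [0..<L]) 0 0 = 0"
      using p by (intro mprod_zero[of p]) (auto simp: M_def coeff_poly_cutoff)
    ultimately show ?thesis by (simp add: lookup_abp_prod_map[OF inj] in_keys_iff)
  next
    case False
    then have "map (\<lambda>p i j. coeff (M p i j) (lookup m (ord p))) [0..<L]
        = map (\<lambda>p i j. coeff ((Ms ! p) i j) (lookup m (ord p))) [0..<L]"
      by (intro map_cong refl ext) (force simp: M_def coeff_poly_cutoff)
    then show ?thesis by (simp only: F lookup_abp_prod_map[OF inj])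
  qed
  then have "F = abp_prod w (map (\<lambda>p. (ord p, M p)) [0..<L]) 0 0"
    by (rule poly_mapping_eqI)
  moreover have "degree (M p i j) \<le> d" for p i j
    by (rule degree_le) (simp add: M_def coeff_poly_cutoff)
  ultimately show ?thesis using that by blast
qed

text \<open>A point is a matrix product with one factor per bit of the position. These bits are the
  exponents of the variables in the corresponding monomial, so matrices with linear entries select
  the right factors.\<close>

lemma roABP_with_coeff_vec_point:
  fixes T :: "nat \<Rightarrow> bool \<Rightarrow> nat \<Rightarrow> nat \<Rightarrow> 'a::comm_ring_1"
  assumes \<sigma>: "bij_betw \<sigma> {..<n} {..<n}" and n: "n \<ge> 1"
  obtains f where "multilinear f" "roABP_computes W n \<sigma> f"
    "\<And>j. coeff_vec n f j = point W T n l (mc_rank n \<sigma> j)"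
proof -
  \<comment> \<open>Step \<open>i\<close> reads \<open>\<sigma> i\<close>, which is bit
    \<open>n - Suc i\<close> of the rank. Every row of the first matrix is row \<open>l\<close> of
    \<open>T\<close>, so that entry (0,0) of the product yields the point with index
    \<open>l\<close>.\<close>
  define N where "N i b r c = T (n - Suc i) b (if i = 0 then l else r) c" for i b r c
  define A where "A i r c = [:N i False r c, N i True r c:]" for i r c
  define f where "f = abp_prod W (map (\<lambda>i. (\<sigma> i, A i)) [0..<n]) 0 0"
  have inj: "inj_on \<sigma> {..<n}" and img: "\<sigma> ` {..<n} = {..<n}"
    using \<sigma> by (auto simp: bij_betw_def)
  have lookup_f: "lookup f m = (if keys m \<subseteq> {..<n}
      then mprod W (map (\<lambda>i r c. coeff (A i r c) (lookup m (\<sigma> i))) [0..<n]) 0 0 else 0)" for m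
    unfolding f_def lookup_abp_prod_map[OF inj] img ..
  have coeff_bit: "coeff (A i r c) (of_bool b) = N i b r c" for i r c b
    by (cases b) (auto simp: A_def)
  have "multilinear f" unfolding multilinear_def
  proof (intro ballI allI, rule ccontr)
    fix m v assume m: "m \<in> keys f" and "\<not> lookup m v \<le> 1"
    then have v: "lookup m v \<ge> 2" by simp
    from m have sub: "keys m \<subseteq> {..<n}"
      and nz: "mprod W (map (\<lambda>i r c. coeff (A i r c) (lookup m (\<sigma> i))) [0..<n]) 0 0 \<noteq> 0"
      by (auto simp: in_keys_iff lookup_f split: if_splits)
    have "v \<in> {..<n}" using sub v by (auto simp: in_keys_iff subset_iff)
    then obtain i where i: "i < n" "\<sigma> i = v" using img by (metis imageE lessThan_iff)
    have "coeff (A i r c) (lookup m (\<sigma> i)) = 0" for r c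
      using v i(2) by (intro coeff_eq_0) (auto simp: A_def)
    then have "mprod W (map (\<lambda>i r c. coeff (A i r c) (lookup m (\<sigma> i))) [0..<n]) 0 0 = 0"
      using i(1) by (intro mprod_zero[of i]) auto
    with nz show False by contradiction
  qed
  moreover have "roABP_computes W n \<sigma> f" unfolding roABP_computes_def
    by (intro exI[of _ "map A [0..<n]"]) (auto simp: f_def zip_map_upt intro!: arg_cong[where f = "\<lambda>xs. abp_prod W xs 0 0"])
  moreover have "coeff_vec n f j = point W T n l (mc_rank n \<sigma> j)" for j
  proof -
    let ?p = "mc_rank n \<sigma> j"
    obtain n' where n': "n = Suc n'" using n by (cases n) auto
    have "keys (ml_monomial n j) \<subseteq> {..<n}"
      by (auto simp: in_keys_iff lookup_ml_monomial)
    moreover have "\<sigma> i < n" if "i < n" for i using img that by blast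
    ultimately have "coeff_vec n f j = mprod W (map (\<lambda>i. N i (bit j (\<sigma> i))) [0..<n]) 0 0"
      unfolding coeff_vec_def lookup_f lookup_ml_monomial coeff_bit
      by (auto intro!: arg_cong[where f = "\<lambda>As. mprod W As 0 0"])
    also have "map (\<lambda>i. N i (bit j (\<sigma> i))) [0..<n] = map (\<lambda>i. N i (bit ?p (n - Suc i))) [0..<n]"
      by (intro map_cong) (auto simp: bit_mc_rank)
    also have "\<dots> = N 0 (bit ?p n') # map (\<lambda>i. T i (bit ?p i)) (rev [0..<n'])"
      unfolding n' by (intro nth_equalityI)
        (auto simp: nth_Cons rev_nth N_def n' fun_eq_iff simp del: upt_Suc split: nat.split)
    also have "mprod W \<dots> 0 0 = point W T n l ?p"
      by (simp add: n' point_Suc mat_mult_def N_def) (simp add: point_def)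
    finally show ?thesis .
  qed
  ultimately show ?thesis using that by blast
qed

text \<open>Two equal powers would give a trivial power whose exponent is the difference of
  theirs.\<close>

lemma inj_on_power_if_order_ge:
  fixes g :: "'a::field"
  assumes "g \<noteq> 0" and ord: "\<And>k. 1 \<le> k \<Longrightarrow> k < K \<Longrightarrow> g ^ k \<noteq> 1"
  shows "inj_on (\<lambda>k. g ^ k) {..<K}"
proof (rule linorder_inj_onI')
  fix i j assume ij: "i \<in> {..<K}" "j \<in> {..<K}" "i < j"
  have "g ^ j = g ^ i * g ^ (j - i)" using ij by (simp flip: power_add)
  moreover have "g ^ (j - i) \<noteq> 1" using ij by (intro ord) auto
  ultimately show "g ^ i \<noteq> g ^ j" using \<open>g \<noteq> 0\<close> by auto
qed

theorem theorem1p10: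
  fixes n w d :: nat
  assumes "n \<ge> 1" and "w \<ge> 1" and "d \<ge> 1"
    and "\<exists>g::'a::field. g \<noteq> 0 \<and>
           (\<forall>k. 1 \<le> k \<and> k < (2 ^ n * d * w ^ 2) ^ 2 \<longrightarrow> g ^ k \<noteq> 1)"
    and "infinite (UNIV :: 'a set) \<or> w ^ 2 \<le> card (UNIV :: 'a set)"
  shows "\<forall>(F :: 'a mpoly) ord.
           monomial_compatible n ord \<and> roABP_computes w (2 ^ n) ord F \<and>
           ind_degree_le d F \<and> F \<noteq> 0 \<longrightarrow>
           (\<exists>(f :: 'a mpoly) \<sigma>. multilinear f \<and> bij_betw \<sigma> {..<n} {..<n} \<and>
              roABP_computes (w ^ 2) n \<sigma> f \<and>
              mpoly_eval (coeff_vec n f) F \<noteq> 0)"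
proof (intro allI impI)
  fix F :: "'a mpoly" and ord
  assume *: "monomial_compatible n ord \<and> roABP_computes w (2 ^ n) ord F \<and> ind_degree_le d F \<and> F \<noteq> 0"
  define R where "R = 2 ^ n * d * w ^ 2"
  obtain g :: 'a where g: "g \<noteq> 0" "\<And>k. 1 \<le> k \<Longrightarrow> k < R ^ 2 \<Longrightarrow> g ^ k \<noteq> 1"
    using assms(4) unfolding R_def by blast
  have R: "R \<le> R ^ 2" "w ^ 2 \<le> R" "d \<le> R" using assms(2,3) by (simp_all add: R_def power2_eq_square)
  have inj_g: "inj_on (\<lambda>k. g ^ k) {..<R ^ 2}"
    using g by (rule inj_on_power_if_order_ge)
  \<comment> \<open>This set has more than \<open>R\<close> elements, enough to avoid all bad
    arguments, and more than \<open>d\<close>, enough nodes for interpolating the entries of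
    \<open>M\<close>.\<close>
  let ?G = "insert 0 ((\<lambda>k. g ^ k) ` {..<R ^ 2})"
  have card_G: "card ?G = Suc (R ^ 2)"
    using g(1) by (subst card_insert_disjoint) (auto simp: card_image[OF inj_g])
  have avail: "\<exists>s. s \<notin> S" if "finite S" "card S \<le> R" for S :: "'a set"
  proof -
    have "\<not> ?G \<subseteq> S" using card_mono[OF that(1), of ?G] that(2) card_G R(1) by linarith
    then show ?thesis by blast
  qed
  obtain \<sigma> where \<sigma>: "bij_betw \<sigma> {..<n} {..<n}" and ord: "\<And>j. j < 2 ^ n \<Longrightarrow> ord (mc_rank n \<sigma> j) = j"
    using * unfolding monomial_compatible_def by blast
  have rank: "mc_rank n \<sigma> (ord p) = p" if p: "p < 2 ^ n" for p
  proof -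
    obtain j where "j < 2 ^ n" "p = mc_rank n \<sigma> j"
      using bij_betw_mc_rank[OF \<sigma>] p unfolding bij_betw_def by (metis imageE lessThan_iff)
    then show ?thesis using ord by simp
  qed
  have inj_ord: "inj_on ord {..<2 ^ n}"
    by (rule inj_on_inverseI[of _ "mc_rank n \<sigma>"]) (simp add: rank)
  obtain M where F: "F = abp_prod w (map (\<lambda>p. (ord p, M p)) [0..<2 ^ n]) 0 0"
    and degM: "\<And>p i j. degree (M p i j) \<le> d"
    using roABP_computes_bounded_degree[of w "2 ^ n" ord F d] * inj_ord by blast
  obtain m where "lookup F m \<noteq> 0"
    using * by (metis lookup_zero poly_mapping_eqI)
  then have "mprod w (map (\<lambda>p i j. coeff (M p i j) (lookup m (ord p))) [0..<2 ^ n]) 0 0 \<noteq> 0"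
    unfolding F lookup_abp_prod_map[OF inj_ord] by presburger
  \<comment> \<open>The coefficient matrices at \<open>m\<close> lie in the spans of the values of
    \<open>M p\<close>, so they can be exchanged for values at one argument per position.\<close>
  then obtain v where v: "mprod w (map (\<lambda>p. eval_mat (M p) (v p)) [0..<2 ^ n]) 0 0 \<noteq> 0"
  proof (rule mprod_nonzero_from_span[rotated 3])
    show "block w (\<lambda>i j. coeff (M p i j) (lookup m (ord p)))
        \<in> mat.span ((\<lambda>s. block w (eval_mat (M p) s)) ` UNIV)" for p
      using degM by (rule coeff_mat_in_span_eval[of _ _ ?G]) (use card_G R in auto)
  qed (use assms(2) in auto)
  have "inj_on (\<lambda>k. g ^ k) {..<w ^ 2}"
    by (rule inj_on_subset[OF inj_g]) (use R order.trans in \<open>simp only: lessThan_subset_iff\<close>)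
  \<comment> \<open>After all \<open>n\<close> merges a single block is left:
    \<open>p div 2 ^ n\<close> is 0 for every position, and the row \<open>c 0\<close> serves all of
    them.\<close>
  then obtain T c where
    "mprod w (map (\<lambda>p. eval_mat (M p) (point (w ^ 2) T n (c (p div 2 ^ n)) p)) [0..<2 ^ n]) 0 0 \<noteq> 0"
    using merged_points_nonzero[of w "n - 1" n M d "\<lambda>k. g ^ k" v] assms(1,2) degM avail v
    unfolding R_def by auto
  moreover obtain f where f: "multilinear f" "roABP_computes (w ^ 2) n \<sigma> f"
    "\<And>j. coeff_vec n f j = point (w ^ 2) T n (c 0) (mc_rank n \<sigma> j)"
    using roABP_with_coeff_vec_point[OF \<sigma> assms(1)] by blast
  moreover have "map (\<lambda>p. eval_mat (M p) (coeff_vec n f (ord p))) [0..<2 ^ n]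
      = map (\<lambda>p. eval_mat (M p) (point (w ^ 2) T n (c (p div 2 ^ n)) p)) [0..<2 ^ n]"
    by (intro map_cong refl) (simp add: f(3) rank)
  ultimately have "mpoly_eval (coeff_vec n f) F \<noteq> 0"
    unfolding F mpoly_eval_abp_prod by (simp only: map_map o_def prod.case not_False_eq_True)
  with f \<sigma> show "\<exists>(f :: 'a mpoly) \<sigma>. multilinear f \<and> bij_betw \<sigma> {..<n} {..<n} \<and>
      roABP_computes (w ^ 2) n \<sigma> f \<and> mpoly_eval (coeff_vec n f) F \<noteq> 0"
    by blast
qed

end
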